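(* Let $T>0$, $\mathbb M,\mathbb N\in\mathcal P(\mathcal P(\mathcal X))$ and $(\mathbb C,\mathbb V)\in\vec{\mathbb{CE}}_T(\mathbb M,\mathbb N)$ with $\int_0^T\vec{\mathbb A}(\mathbb C(t),\mathbb V(t))dt<\infty$. Then there exists a measurable $\mathbb\Psi:[0,T]\times\mathcal P(\mathcal X)\to\mathbb R^{\mathcal X}$ such that $(\mathbb C,\mathbb\Psi)\in\mathbb{CE}_T(\mathbb M,\mathbb N)$ and $$\int_0^T\mathbb A(\mathbb C(t),\mathbb\Psi(t))dt\le\int_0^T\vec{\mathbb A}(\mathbb C(t),\mathbb V(t))dt.$$
   Context: $\mathcal X=\{1,\dots,d\}$ finite, $\mathcal P(\mathcal X)\subset\mathbb R^{\mathcal X}$. $\{Q(\mu)\}$ rate matrices ($Q_{xy}\ge0$, $x\ne y$), each irreducible and reversible w.r.t. a Gibbs measure, with $\mu\mapsto Q_{xy}(\mu)$ Lipschitz. $\Lambda(s,t)=\int_0^1s^\alpha t^{1-\alpha}d\alpha$, $w_{xy}(\mu)=\Lambda(\mu_xQ_{xy}(\mu),\mu_yQ_{yx}(\mu))$. $\alpha(v,w)=v^2/w$ if $w>0$, $0$ if $v=w=0$, $+\infty$ else; $\vec{\mathcal A}(\mu,v)=\frac12\sum_{x,y}\alpha(v_{xy},w_{xy}(\mu))$, $\mathcal A(\mu,\psi)=\frac12\sum_{x,y}(\psi_y-\psi_x)^2w_{xy}(\mu)$. Lifted: for $\mathbb V:[0,T]\times\mathcal P(\mathcal X)\to\mathbb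 R^{\mathcal X\times\mathcal X}$, $(\delta\mathbb V)_x=\frac12\sum_y(\mathbb V_{xy}-\mathbb V_{yx})$. $(\mathbb C,\mathbb V)\in\vec{\mathbb{CE}}_T(\mathbb M,\mathbb N)$ if $t\mapsto\mathbb C(t)\in\mathcal P(\mathcal P(\mathcal X))$ is weakly continuous, $\mathbb C(0)=\mathbb M$, $\mathbb C(T)=\mathbb N$, $\mathbb V$ is measurable and integrable w.r.t. $\mathbb C(t,d\nu)dt$, and $\int_0^T\int(\partial_t\varphi-\langle\nabla\varphi,\delta\mathbb V\rangle)\mathbb C(t,d\nu)dt=0$ for all $\varphi\in C^1_c((0,T)\times\mathbb R^{\mathcal X})$. $(\mathbb C,\mathbb\Psi)\in\mathbb{CE}_T(\mathbb M,\mathbb N)$ if this holds with $\mathbb V_{xy}(t,\nu)=w_{xy}(\nu)(\mathbb\Psi_y(t,\nu)-\mathbb\Psi_x(t,\nu))$. $\vec{\mathbb A}(\mathbb M,\mathbb V)=\int\vec{\mathcal A}(\nu,\mathbb V(\nu))\mathbb M(d\nu)$, $\mathbb A(\mathbb M,\mathbb\Psi)=\int\mathcal A(\nu,\mathbb\Psi(\nu))\mathbb M(d\nu)$. *)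

theory Defs
  imports "HOL-Probability.Probability"
begin

text \<open>States: a finite type 'x. Probability vectors P(X) live in real^'x.\<close>

definition prob_simplex :: "(real^'x::finite) set" where
  "prob_simplex = {\<mu>. (\<forall>x. 0 \<le> \<mu>$x) \<and> (\<Sum>x\<in>UNIV. \<mu>$x) = 1}"

text \<open>P(P(X)): Borel probability measures on real^'x concentrated on the prob_simplex.\<close>
definition PP :: "(real^'x::finite) measure set" where
  "PP = {M. prob_space M \<and> sets M = sets borel \<and> emeasure M prob_simplex = 1}"

definition irreducible_rates :: "('x \<Rightarrow> 'x \<Rightarrow> real) \<Rightarrow> bool" where
  "irreducible_rates q \<longleftrightarrow> (\<forall>x y. (x, y) \<in> {(a, b). a \<noteq> b \<and> 0 < q a b}\<^sup>*)"

text \<open>Reversibility w.r.t. a Gibbs measure, i.e. a strictly positive probability vector.\<close>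
definition reversible_gibbs :: "('x::finite \<Rightarrow> 'x \<Rightarrow> real) \<Rightarrow> bool" where
  "reversible_gibbs q \<longleftrightarrow> (\<exists>\<pi>::'x \<Rightarrow> real. (\<forall>x. 0 < \<pi> x) \<and> (\<Sum>x\<in>UNIV. \<pi> x) = 1 \<and>
      (\<forall>x y. \<pi> x * q x y = \<pi> y * q y x))"

text \<open>Logarithmic mean \<Lambda>(s,t) = \<integral>_0^1 s^a t^(1-a) da.\<close>
definition Lam :: "real \<Rightarrow> real \<Rightarrow> real" where
  "Lam s t = integral {0..1} (\<lambda>a. s powr a * t powr (1 - a))"

definition wt :: "(real^'x \<Rightarrow> 'x \<Rightarrow> 'x \<Rightarrow> real) \<Rightarrow> real^'x \<Rightarrow> 'x \<Rightarrow> 'x \<Rightarrow> real" where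
  "wt Q \<mu> x y = Lam (\<mu>$x * Q \<mu> x y) (\<mu>$y * Q \<mu> y x)"

definition alpha :: "real \<Rightarrow> real \<Rightarrow> ennreal" where
  "alpha v w = (if 0 < w then ennreal (v\<^sup>2 / w) else if v = 0 \<and> w = 0 then 0 else \<infinity>)"

text \<open>Actions; sums over ordered pairs x \<noteq> y (diagonal terms of the rate matrix play no role).\<close>
definition vecA :: "(real^'x::finite \<Rightarrow> 'x \<Rightarrow> 'x \<Rightarrow> real) \<Rightarrow> real^'x \<Rightarrow> ('x \<Rightarrow> 'x \<Rightarrow> real) \<Rightarrow> ennreal" where
  "vecA Q \<mu> v = ennreal (1/2) * (\<Sum>x\<in>UNIV. \<Sum>y\<in>UNIV - {x}. alpha (v x y) (wt Q \<mu> x y))"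

definition Aact :: "(real^'x::finite \<Rightarrow> 'x \<Rightarrow> 'x \<Rightarrow> real) \<Rightarrow> real^'x \<Rightarrow> ('x \<Rightarrow> real) \<Rightarrow> ennreal" where
  "Aact Q \<mu> \<psi> = ennreal ((1/2) * (\<Sum>x\<in>UNIV. \<Sum>y\<in>UNIV - {x}. (\<psi> y - \<psi> x)\<^sup>2 * wt Q \<mu> x y))"

definition divV :: "('x::finite \<Rightarrow> 'x \<Rightarrow> real) \<Rightarrow> real^'x" where
  "divV v = (\<chi> x. (1/2) * (\<Sum>y\<in>UNIV. v x y - v y x))"

definition weakly_cont :: "real \<Rightarrow> (real \<Rightarrow> (real^'x::finite) measure) \<Rightarrow> bool" where
  "weakly_cont T C \<longleftrightarrow> (\<forall>f :: real^'x \<Rightarrow> real. continuous_on UNIV f \<and> bounded (range f) \<longrightarrow>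
      continuous_on {0..T} (\<lambda>t. \<integral>\<nu>. f \<nu> \<partial>C t))"

text \<open>\<phi> \<in> C^1_c((0,T) \<times> R^X) with gradient D (D(z) = (\<partial>_t\<phi>, \<nabla>\<phi>)).\<close>
definition test_fun :: "real \<Rightarrow> (real \<times> (real^'x::finite) \<Rightarrow> real) \<Rightarrow> (real \<times> (real^'x) \<Rightarrow> real \<times> (real^'x)) \<Rightarrow> bool" where
  "test_fun T \<phi> D \<longleftrightarrow> (\<forall>z. (\<phi> has_derivative (\<lambda>h. D z \<bullet> h)) (at z)) \<and> continuous_on UNIV D \<and>
      (\<exists>K. compact K \<and> K \<subseteq> {0<..<T} \<times> UNIV \<and> (\<forall>z. z \<notin> K \<longrightarrow> \<phi> z = 0))"

definition vCE :: "real \<Rightarrow> (real^'x::finite) measure \<Rightarrow> (real^'x) measure \<Rightarrow> (real \<Rightarrow> (real^'x) measure)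
     \<Rightarrow> (real \<Rightarrow> real^'x \<Rightarrow> 'x \<Rightarrow> 'x \<Rightarrow> real) \<Rightarrow> bool" where
  "vCE T M N C V \<longleftrightarrow>
     (\<forall>t\<in>{0..T}. C t \<in> PP) \<and> weakly_cont T C \<and> C 0 = M \<and> C T = N \<and>
     (\<forall>x y. (\<lambda>(t, \<nu>). V t \<nu> x y) \<in> borel_measurable borel) \<and>
     (\<forall>x y. (\<integral>\<^sup>+ t. indicator {0..T} t * (\<integral>\<^sup>+ \<nu>. ennreal \<bar>V t \<nu> x y\<bar> \<partial>C t) \<partial>lborel) < \<infinity>) \<and>
     (\<forall>\<phi> D. test_fun T \<phi> D \<longrightarrow>
        (\<integral>t. indicator {0..T} t * (\<integral>\<nu>. fst (D (t, \<nu>)) - snd (D (t, \<nu>)) \<bullet> divV (V t \<nu>) \<partial>C t) \<partial>lborel) = 0)"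

definition CE :: "(real^'x::finite \<Rightarrow> 'x \<Rightarrow> 'x \<Rightarrow> real) \<Rightarrow> real \<Rightarrow> (real^'x) measure \<Rightarrow> (real^'x) measure
     \<Rightarrow> (real \<Rightarrow> (real^'x) measure) \<Rightarrow> (real \<Rightarrow> real^'x \<Rightarrow> 'x \<Rightarrow> real) \<Rightarrow> bool" where
  "CE Q T M N C \<Psi> \<longleftrightarrow> vCE T M N C (\<lambda>t \<nu> x y. wt Q \<nu> x y * (\<Psi> t \<nu> y - \<Psi> t \<nu> x))"

definition vAction :: "(real^'x::finite \<Rightarrow> 'x \<Rightarrow> 'x \<Rightarrow> real) \<Rightarrow> real \<Rightarrow> (real \<Rightarrow> (real^'x) measure)
     \<Rightarrow> (real \<Rightarrow> real^'x \<Rightarrow> 'x \<Rightarrow> 'x \<Rightarrow> real) \<Rightarrow> ennreal" where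
  "vAction Q T C V = (\<integral>\<^sup>+ t. indicator {0..T} t * (\<integral>\<^sup>+ \<nu>. vecA Q \<nu> (V t \<nu>) \<partial>C t) \<partial>lborel)"

definition Action :: "(real^'x::finite \<Rightarrow> 'x \<Rightarrow> 'x \<Rightarrow> real) \<Rightarrow> real \<Rightarrow> (real \<Rightarrow> (real^'x) measure)
     \<Rightarrow> (real \<Rightarrow> real^'x \<Rightarrow> 'x \<Rightarrow> real) \<Rightarrow> ennreal" where
  "Action Q T C \<Psi> = (\<integral>\<^sup>+ t. indicator {0..T} t * (\<integral>\<^sup>+ \<nu>. Aact Q \<nu> (\<Psi> t \<nu>) \<partial>C t) \<partial>lborel)"

end

theory Submission
  imports Defs
begin

text \<open>For each time \<open>t\<close> and state \<open>\<nu>\<close>, the flux \<open>V t \<nu>\<close> is replaced by the gradient flux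
  \<open>w (\<psi>\<^sub>y - \<psi>\<^sub>x)\<close> of least Dirichlet energy with the same divergence, where \<open>\<psi>\<close> solves
  \<open>L\<^sub>w \<psi> = -2 div V\<close> for the weighted graph Laplacian \<open>L\<^sub>w\<close>. Pairing \<open>-2 div V\<close> with a potential
  \<open>q\<close> gives \<open>\<Sum> V\<^sub>x\<^sub>y (q\<^sub>y - q\<^sub>x)\<close>, which Cauchy-Schwarz on each edge bounds by the vector
  action of \<open>V\<close> plus half the Dirichlet energy \<open>q \<bullet> L\<^sub>w q\<close>. This makes the system solvable, and
  for \<open>q = \<psi>\<close> it bounds the action of \<open>\<psi>\<close> by the vector action of \<open>V\<close>.
  Choosing \<open>\<psi>\<close> as the limit of the Tikhonov-regularised solutions of \<open>(L\<^sub>w + \<epsilon> I) \<psi> = -2 div V\<close>,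
  which Cramer's rule makes explicit, makes it measurable in \<open>(t, \<nu>)\<close>. The continuity equation sees
  the flux only through its divergence, and the new flux is integrable since
  \<open>|w g| \<le> w/2 + w g\<^sup>2/2\<close>.\<close>

section \<open>Tikhonov regularisation\<close>

definition cramer_solve :: "real^'n::finite^'n \<Rightarrow> real^'n \<Rightarrow> real^'n" where
  "cramer_solve A b = (\<chi> k. det (\<chi> i j. if j = k then b$i else A$i$j) / det A)"

lemma cramer_solve_eq: "det A \<noteq> 0 \<Longrightarrow> A *v cramer_solve A b = b"
  using cramer[of A] unfolding cramer_solve_def by simp

lemma measurable_det[measurable]:
  fixes A :: "'a \<Rightarrow> real^'n::finite^'n"
  assumes "\<And>i j. (\<lambda>a. A a $ i $ j) \<in> borel_measurable M"
  shows "(\<lambda>a. det (A a)) \<in> borel_measurable M"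
  unfolding det_def using assms by measurable

lemma measurable_cramer_solve[measurable]:
  fixes A :: "'a \<Rightarrow> real^'n::finite^'n"
  assumes [measurable]: "\<And>i j. (\<lambda>a. A a $ i $ j) \<in> borel_measurable M"
    and [measurable]: "\<And>i. (\<lambda>a. b a $ i) \<in> borel_measurable M"
  shows "(\<lambda>a. cramer_solve (A a) (b a) $ k) \<in> borel_measurable M"
proof -
  have [measurable]: "(\<lambda>a. (\<chi> i j. if j = k then b a $ i else A a $ i $ j) $ i $ j) \<in> borel_measurable M"
    for i j by simp
  show ?thesis
    unfolding cramer_solve_def vec_lambda_beta by (intro borel_measurable_divide measurable_det) auto
qed

lemma det_psd_plus_scaleR_mat_nonzero:
  fixes A :: "real^'n::finite^'n"
  assumes psd: "\<And>q. 0 \<le> q \<bullet> (A *v q)" and e: "0 < e"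
  shows "det (A + e *\<^sub>R mat 1) \<noteq> 0"
proof -
  have "q = 0" if "(A + e *\<^sub>R mat 1) *v q = 0" for q
  proof -
    have "q \<bullet> (A *v q) + e * (q \<bullet> q) = 0"
      using arg_cong[OF that, of "inner q"]
      by (simp add: algebra_simps scaleR_matrix_vector_assoc[symmetric])
    moreover have "0 \<le> e * (q \<bullet> q)" using e by simp
    ultimately have "e * (q \<bullet> q) = 0" using psd[of q] by linarith
    then have "q \<bullet> q = 0" using e by simp
    then show ?thesis by simp
  qed
  then show ?thesis
    by (simp add: invertible_det_nz[symmetric] invertible_left_inverse matrix_left_invertible_ker)
qed

text \<open>The regularised solutions are given by Cramer's rule and hence depend measurably on the
  data; their limit is therefore a measurable choice of a solution of \<open>A p = b\<close>.\<close>
definition tikhonov :: "real^'n::finite^'n \<Rightarrow> real^'n \<Rightarrow> real \<Rightarrow> real^'n" where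
  "tikhonov A b e = cramer_solve (A + e *\<^sub>R mat 1) b"

definition tikhonov_limit :: "real^'n::finite^'n \<Rightarrow> real^'n \<Rightarrow> real^'n" where
  "tikhonov_limit A b = lim (\<lambda>n. tikhonov A b (1 / real (Suc n)))"

context
  fixes A :: "real^'n::finite^'n"
  assumes psd: "\<And>q. 0 \<le> q \<bullet> (A *v q)"
begin

lemma tikhonov_eq: "0 < e \<Longrightarrow> A *v tikhonov A b e + e *\<^sub>R tikhonov A b e = b"
  using cramer_solve_eq[OF det_psd_plus_scaleR_mat_nonzero[OF psd]]
  unfolding tikhonov_def by (simp add: algebra_simps scaleR_matrix_vector_assoc[symmetric])

lemma tendsto_tikhonov_image:
  assumes small: "(\<lambda>n. e n *\<^sub>R tikhonov A b (e n)) \<longlonglongrightarrow> 0" and e: "\<And>n. 0 < e n"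
  shows "(\<lambda>n. A *v tikhonov A b (e n)) \<longlonglongrightarrow> b"
proof -
  have "(\<lambda>n. b - e n *\<^sub>R tikhonov A b (e n)) \<longlonglongrightarrow> b - 0"
    by (intro tendsto_diff tendsto_const small)
  moreover have "A *v tikhonov A b (e n) = b - e n *\<^sub>R tikhonov A b (e n)" for n
    using tikhonov_eq[OF e] by (simp add: algebra_simps)
  ultimately show ?thesis by simp
qed

lemma tikhonov_range:
  assumes bound: "\<And>q. b \<bullet> q \<le> S + q \<bullet> (A *v q)"
  shows "b \<in> range ((*v) A)"
proof -
  define e :: "nat \<Rightarrow> real" where "e n = 1 / real (Suc n)" for n
  define p where "p n = tikhonov A b (e n)" for n
  have epos: "0 < e n" for n by (simp add: e_def)
  have eq: "A *v p n + e n *\<^sub>R p n = b" for n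
    unfolding p_def by (rule tikhonov_eq[OF epos])
  have small: "(norm (e n *\<^sub>R p n))\<^sup>2 \<le> e n * S" for n
  proof -
    have "p n \<bullet> (A *v p n) + e n * (p n \<bullet> p n) = b \<bullet> p n"
      using arg_cong[OF eq[of n], of "\<lambda>v. p n \<bullet> v"] by (simp add: inner_add_right inner_commute)
    with bound[of "p n"] have "e n * (p n \<bullet> p n) \<le> S" by linarith
    then have "e n * (e n * (p n \<bullet> p n)) \<le> e n * S"
      using epos[of n] by (rule mult_left_mono[OF _ less_imp_le])
    moreover have "(norm (e n *\<^sub>R p n))\<^sup>2 = e n * (e n * (p n \<bullet> p n))"
      by (simp add: power_mult_distrib power2_norm_eq_inner[symmetric] power2_eq_square)
    ultimately show ?thesis by simp
  qed
  have e0: "e \<longlonglongrightarrow> 0"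
    unfolding e_def using LIMSEQ_inverse_real_of_nat by (simp add: inverse_eq_divide)
  have "(\<lambda>n. e n *\<^sub>R p n) \<longlonglongrightarrow> 0"
  proof (rule Lim_null_comparison)
    show "\<forall>\<^sub>F n in sequentially. norm (e n *\<^sub>R p n) \<le> sqrt (e n * S)"
      using small by (intro always_eventually allI real_le_rsqrt)
    show "(\<lambda>n. sqrt (e n * S)) \<longlonglongrightarrow> 0"
      using tendsto_real_sqrt[OF tendsto_mult[OF e0 tendsto_const[of S]]] by simp
  qed
  then have "(\<lambda>n. A *v p n) \<longlonglongrightarrow> b"
    unfolding p_def by (rule tendsto_tikhonov_image) (rule epos)
  moreover have "closed (range ((*v) A))"
    by (intro closed_subspace linear_subspace_image matrix_vector_mul_linear subspace_UNIV)
  ultimately show ?thesis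
    using closed_sequentially[of "range ((*v) A)" "\<lambda>n. A *v p n" b] by simp
qed

context
  fixes b \<eta> :: "real^'n"
  assumes \<eta>: "A *v \<eta> = b"
begin

lemma norm_tikhonov_le:
  assumes e: "0 < e"
  shows "norm (tikhonov A b e) \<le> norm \<eta>"
proof -
  define p where "p = tikhonov A b e"
  have "A *v (p - \<eta>) = - (e *\<^sub>R p)"
    using tikhonov_eq[OF e, of b] \<eta> unfolding p_def by (simp add: matrix_vector_mult_diff_distrib algebra_simps)
  then have "0 \<le> - e * ((p - \<eta>) \<bullet> p)"
    using psd[of "p - \<eta>"] by simp
  then have "p \<bullet> p \<le> \<eta> \<bullet> p"
    using e by (simp add: mult_le_0_iff inner_diff_left)
  also have "\<dots> \<le> norm \<eta> * norm p" by (rule norm_cauchy_schwarz)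
  finally have "norm p * norm p \<le> norm \<eta> * norm p"
    by (simp add: power2_norm_eq_inner[symmetric] power2_eq_square)
  then show ?thesis unfolding p_def
    by (cases "norm (tikhonov A b e) = 0") (auto simp: mult_le_cancel_right)
qed

lemma norm_tikhonov_step:
  assumes e': "0 < e'" and le: "e' \<le> e"
  shows "(norm (tikhonov A b e))\<^sup>2 + (norm (tikhonov A b e' - tikhonov A b e))\<^sup>2
           \<le> (norm (tikhonov A b e'))\<^sup>2"
proof -
  define p where "p = tikhonov A b e"
  define d where "d = tikhonov A b e' - p"
  have e: "0 < e" using e' le by linarith
  have "A *v d = - (e' *\<^sub>R d) + (e - e') *\<^sub>R p"
    using tikhonov_eq[OF e, of b] tikhonov_eq[OF e', of b] unfolding d_def p_def
    by (simp add: matrix_vector_mult_diff_distrib algebra_simps)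
  then have "d \<bullet> (A *v d) = - e' * (d \<bullet> d) + (e - e') * (d \<bullet> p)"
    by (simp add: inner_add_right inner_diff_right)
  moreover have "0 \<le> e' * (d \<bullet> d)" using e' by simp
  ultimately have "0 \<le> (e - e') * (d \<bullet> p)"
    using psd[of d] by linarith
  then have "0 \<le> d \<bullet> p"
  proof (cases "e' = e")
    case True then show ?thesis by (simp add: d_def p_def)
  next
    case False
    then have "0 < e - e'" using le by simp
    with \<open>0 \<le> (e - e') * (d \<bullet> p)\<close> show ?thesis by (simp add: zero_le_mult_iff)
  qed
  moreover have "tikhonov A b e' = p + d" by (simp add: d_def)
  ultimately show ?thesis
    unfolding d_def[symmetric] p_def[symmetric] power2_norm_eq_inner
    by (simp add: inner_add_left inner_add_right inner_commute[of p d])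
qed

end

lemma tikhonov_Cauchy:
  assumes "b \<in> range ((*v) A)"
  shows "Cauchy (\<lambda>n. tikhonov A b (1 / real (Suc n)))"
proof -
  obtain \<eta> where \<eta>: "A *v \<eta> = b" using assms by blast
  define p where "p n = tikhonov A b (1 / real (Suc n))" for n
  have step: "(norm (p n))\<^sup>2 + (norm (p m - p n))\<^sup>2 \<le> (norm (p m))\<^sup>2" if "n \<le> m" for m n
    unfolding p_def using that by (intro norm_tikhonov_step[OF \<eta>]) (auto simp: frac_le)
  have "incseq (\<lambda>n. (norm (p n))\<^sup>2)"
  proof (rule incseq_SucI)
    show "(norm (p n))\<^sup>2 \<le> (norm (p (Suc n)))\<^sup>2" for n
      using step[of n "Suc n"] zero_le_power2[of "norm (p (Suc n) - p n)"] by linarith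
  qed
  moreover have "(norm (p n))\<^sup>2 \<le> (norm \<eta>)\<^sup>2" for n
    unfolding p_def by (intro power_mono norm_tikhonov_le[OF \<eta>]) auto
  ultimately obtain L where "(\<lambda>n. (norm (p n))\<^sup>2) \<longlonglongrightarrow> L"
    using incseq_convergent by blast
  then have norms: "Cauchy (\<lambda>n. (norm (p n))\<^sup>2)" by (rule LIMSEQ_imp_Cauchy)
  show ?thesis
  proof (fold p_def, rule metric_CauchyI)
    fix r :: real assume r: "0 < r"
    obtain N where N: "\<forall>m\<ge>N. \<forall>n\<ge>N. dist ((norm (p m))\<^sup>2) ((norm (p n))\<^sup>2) < r\<^sup>2"
      using metric_CauchyD[OF norms, of "r\<^sup>2"] r by auto
    have ordered: "dist (p m) (p n) < r" if "N \<le> n" "n \<le> m" for m n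
    proof -
      have "(dist (p m) (p n))\<^sup>2 \<le> (norm (p m))\<^sup>2 - (norm (p n))\<^sup>2"
        using step[OF that(2)] by (simp add: dist_norm)
      also have "\<dots> < r\<^sup>2"
        using N that by (fastforce simp: dist_real_def abs_less_iff)
      finally show ?thesis using r by (simp add: power_less_imp_less_base)
    qed
    then have "dist (p m) (p n) < r" if "N \<le> n" "N \<le> m" for m n
      using that by (metis ordered dist_commute nat_le_linear)
    then show "\<exists>N. \<forall>m\<ge>N. \<forall>n\<ge>N. dist (p m) (p n) < r" by blast
  qed
qed

lemma tendsto_tikhonov_limit:
  "b \<in> range ((*v) A) \<Longrightarrow>
     (\<lambda>n. tikhonov A b (1 / real (Suc n))) \<longlonglongrightarrow> tikhonov_limit A b"
  using Cauchy_convergent[OF tikhonov_Cauchy]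
  unfolding tikhonov_limit_def by (simp add: convergent_LIMSEQ_iff)

lemma tikhonov_limit_solves:
  assumes b: "b \<in> range ((*v) A)"
  shows "A *v tikhonov_limit A b = b"
proof -
  obtain \<eta> where \<eta>: "A *v \<eta> = b" using b by blast
  define e :: "nat \<Rightarrow> real" where "e n = 1 / real (Suc n)" for n
  define p where "p n = tikhonov A b (e n)" for n
  have "(\<lambda>n. e n *\<^sub>R p n) \<longlonglongrightarrow> 0"
  proof (rule Lim_null_comparison)
    show "\<forall>\<^sub>F n in sequentially. norm (e n *\<^sub>R p n) \<le> e n * norm \<eta>"
      unfolding p_def e_def using norm_tikhonov_le[OF \<eta>]
      by (intro always_eventually allI) (simp add: divide_right_mono)
    show "(\<lambda>n. e n * norm \<eta>) \<longlonglongrightarrow> 0"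
      unfolding e_def using tendsto_mult_left_zero[OF LIMSEQ_inverse_real_of_nat]
      by (simp add: inverse_eq_divide)
  qed
  then have "(\<lambda>n. A *v p n) \<longlonglongrightarrow> b"
    unfolding p_def by (rule tendsto_tikhonov_image) (simp add: e_def)
  moreover have "(\<lambda>n. A *v p n) \<longlonglongrightarrow> A *v tikhonov_limit A b"
    using bounded_linear.tendsto[OF matrix_vector_mul_bounded_linear tendsto_tikhonov_limit[OF b]]
    by (simp add: p_def e_def)
  ultimately show ?thesis by (rule LIMSEQ_unique[rotated])
qed

end

section \<open>Graph Laplacian and minimal-energy potentials\<close>

definition graph_laplacian :: "('x::finite \<Rightarrow> 'x \<Rightarrow> real) \<Rightarrow> real^'x^'x" where
  "graph_laplacian w = (\<chi> z y. (if z = y then (\<Sum>u\<in>UNIV. w u z + w z u) else 0) - (w y z + w z y))"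

definition dirichlet_energy :: "('x::finite \<Rightarrow> 'x \<Rightarrow> real) \<Rightarrow> real^'x \<Rightarrow> real" where
  "dirichlet_energy w p = (\<Sum>x\<in>UNIV. \<Sum>y\<in>UNIV. w x y * (p$y - p$x)\<^sup>2)"

lemma inner_divV: "p \<bullet> divV V = - (\<Sum>x\<in>UNIV. \<Sum>y\<in>UNIV. V x y * (p$y - p$x)) / 2"
proof -
  have "p \<bullet> divV V = ((\<Sum>x\<in>UNIV. \<Sum>y\<in>UNIV. V x y * p$x) - (\<Sum>x\<in>UNIV. \<Sum>y\<in>UNIV. V y x * p$x)) / 2"
    by (simp add: inner_vec_def divV_def sum_distrib_left sum_distrib_right sum_subtractf
        sum_divide_distrib algebra_simps)
  also have "(\<Sum>x\<in>UNIV. \<Sum>y\<in>UNIV. V y x * p$x) = (\<Sum>x\<in>UNIV. \<Sum>y\<in>UNIV. V x y * p$y)"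
    by (rule sum.swap)
  finally show ?thesis
    by (simp add: sum_subtractf[symmetric] sum_negf[symmetric] algebra_simps)
qed

lemma graph_laplacian_mult:
  "graph_laplacian w *v p = - 2 *\<^sub>R divV (\<lambda>x y. w x y * (p$y - p$x))"
proof -
  have "(graph_laplacian w *v p)$z = (\<Sum>y\<in>UNIV. (w y z + w z y) * (p$z - p$y))" for z
  proof -
    have "(graph_laplacian w *v p)$z
        = (\<Sum>y\<in>UNIV. (if z = y then (\<Sum>u\<in>UNIV. w u z + w z u) * p$y else 0) - (w y z + w z y) * p$y)"
      unfolding matrix_vector_mult_def graph_laplacian_def by (auto intro!: sum.cong simp: algebra_simps)
    also have "\<dots> = (\<Sum>y\<in>UNIV. (w y z + w z y) * (p$z - p$y))"
      by (simp add: sum_subtractf sum_distrib_left sum_distrib_right sum.distrib algebra_simps)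
    finally show ?thesis .
  qed
  then show ?thesis
    by (simp add: vec_eq_iff divV_def sum_distrib_left sum_negf[symmetric] algebra_simps)
qed

lemma inner_graph_laplacian: "p \<bullet> (graph_laplacian w *v p) = dirichlet_energy w p"
  by (simp add: graph_laplacian_mult inner_divV dirichlet_energy_def power2_eq_square mult.assoc)

lemma dirichlet_energy_nonneg: "(\<And>x y. 0 \<le> w x y) \<Longrightarrow> 0 \<le> dirichlet_energy w p"
  unfolding dirichlet_energy_def by (intro sum_nonneg mult_nonneg_nonneg) auto

text \<open>Only the part of a flux carried by edges of positive weight can be written as the flux of
  a potential.\<close>
definition edge_flux :: "('x \<Rightarrow> 'x \<Rightarrow> real) \<Rightarrow> ('x \<Rightarrow> 'x \<Rightarrow> real) \<Rightarrow> 'x \<Rightarrow> 'x \<Rightarrow> real" where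
  "edge_flux w V x y = (if x \<noteq> y \<and> 0 < w x y then V x y else 0)"

definition flux_energy :: "('x::finite \<Rightarrow> 'x \<Rightarrow> real) \<Rightarrow> ('x \<Rightarrow> 'x \<Rightarrow> real) \<Rightarrow> real" where
  "flux_energy w V = (\<Sum>x\<in>UNIV. \<Sum>y\<in>UNIV. if x \<noteq> y \<and> 0 < w x y then (V x y)\<^sup>2 / w x y else 0)"

lemma edge_flux_pairing_le:
  assumes w: "\<And>x y. 0 \<le> w x y"
  shows "(\<Sum>x\<in>UNIV. \<Sum>y\<in>UNIV. edge_flux w V x y * (q$y - q$x))
           \<le> flux_energy w V / 2 + dirichlet_energy w q / 2"
proof -
  have "edge_flux w V x y * g
      \<le> (if x \<noteq> y \<and> 0 < w x y then (V x y)\<^sup>2 / w x y else 0) / 2 + w x y * g\<^sup>2 / 2" for x y g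
  proof (cases "x \<noteq> y \<and> 0 < w x y")
    case True
    then have "0 \<le> (V x y - w x y * g)\<^sup>2 / w x y" by simp
    also have "(V x y - w x y * g)\<^sup>2 / w x y = (V x y)\<^sup>2 / w x y - 2 * V x y * g + w x y * g\<^sup>2"
      using True by (simp add: power2_eq_square field_simps)
    finally show ?thesis using True by (simp add: edge_flux_def)
  qed (use w in \<open>auto simp: edge_flux_def\<close>)
  then have "(\<Sum>x\<in>UNIV. \<Sum>y\<in>UNIV. edge_flux w V x y * (q$y - q$x))
      \<le> (\<Sum>x\<in>UNIV. \<Sum>y\<in>UNIV. (if x \<noteq> y \<and> 0 < w x y then (V x y)\<^sup>2 / w x y else 0) / 2
            + w x y * (q$y - q$x)\<^sup>2 / 2)"
    by (intro sum_mono)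
  also have "\<dots> = flux_energy w V / 2 + dirichlet_energy w q / 2"
    unfolding flux_energy_def dirichlet_energy_def by (simp add: sum.distrib sum_divide_distrib)
  finally show ?thesis .
qed

text \<open>Since \<open>graph_laplacian w *v p = -2 div (w \<nabla>p)\<close>, this solves \<open>div (w \<nabla>p) = div V\<close> for the part
  of \<open>V\<close> on edges of positive weight.\<close>
definition min_energy_potential :: "('x::finite \<Rightarrow> 'x \<Rightarrow> real) \<Rightarrow> ('x \<Rightarrow> 'x \<Rightarrow> real) \<Rightarrow> real^'x" where
  "min_energy_potential w V = tikhonov_limit (graph_laplacian w) (- 2 *\<^sub>R divV (edge_flux w V))"

context
  fixes w V :: "'x::finite \<Rightarrow> 'x \<Rightarrow> real"
  assumes w: "\<And>x y. 0 \<le> w x y"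
begin

lemma graph_laplacian_psd: "0 \<le> q \<bullet> (graph_laplacian w *v q)"
  by (simp add: inner_graph_laplacian dirichlet_energy_nonneg w)

lemma edge_flux_divergence_range:
  "- 2 *\<^sub>R divV (edge_flux w V) \<in> range ((*v) (graph_laplacian w))"
proof (rule tikhonov_range[OF graph_laplacian_psd])
  show "(- 2 *\<^sub>R divV (edge_flux w V)) \<bullet> q \<le> flux_energy w V / 2 + q \<bullet> (graph_laplacian w *v q)" for q
    using edge_flux_pairing_le[where w=w and V=V and q=q, OF w] dirichlet_energy_nonneg[where w=w and p=q, OF w]
    by (simp add: inner_commute[of _ q] inner_divV inner_graph_laplacian)
qed

lemma tendsto_min_energy_potential:
  "(\<lambda>n. tikhonov (graph_laplacian w) (- 2 *\<^sub>R divV (edge_flux w V)) (1 / real (Suc n)))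
     \<longlonglongrightarrow> min_energy_potential w V"
  unfolding min_energy_potential_def
  by (rule tendsto_tikhonov_limit[OF graph_laplacian_psd edge_flux_divergence_range])

lemma divV_min_energy_potential:
  defines "p \<equiv> min_energy_potential w V"
  shows "divV (\<lambda>x y. w x y * (p$y - p$x)) = divV (edge_flux w V)"
  using tikhonov_limit_solves[OF graph_laplacian_psd edge_flux_divergence_range]
  unfolding p_def min_energy_potential_def graph_laplacian_mult by simp

lemma dirichlet_energy_min_energy_potential_le:
  "dirichlet_energy w (min_energy_potential w V) \<le> flux_energy w V"
proof -
  let ?p = "min_energy_potential w V"
  have "dirichlet_energy w ?p = ?p \<bullet> (- 2 *\<^sub>R divV (edge_flux w V))"
    using divV_min_energy_potential
    by (simp add: inner_graph_laplacian[symmetric] graph_laplacian_mult)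
  also have "\<dots> \<le> flux_energy w V / 2 + dirichlet_energy w ?p / 2"
    using edge_flux_pairing_le[where w=w and V=V and q="?p", OF w] by (simp add: inner_divV)
  finally show ?thesis by simp
qed

end

lemma measurable_min_energy_potential:
  fixes w V :: "'a \<Rightarrow> 'x::finite \<Rightarrow> 'x \<Rightarrow> real"
  assumes [measurable]: "\<And>x y. (\<lambda>a. w a x y) \<in> borel_measurable M"
    and [measurable]: "\<And>x y. (\<lambda>a. V a x y) \<in> borel_measurable M"
    and w: "\<And>a x y. a \<in> space M \<Longrightarrow> 0 \<le> w a x y"
  shows "(\<lambda>a. min_energy_potential (w a) (V a) $ k) \<in> borel_measurable M"
proof (rule borel_measurable_LIMSEQ_real)
  fix a assume "a \<in> space M"
  then show "(\<lambda>n. tikhonov (graph_laplacian (w a)) (- 2 *\<^sub>R divV (edge_flux (w a) (V a)))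
      (1 / real (Suc n)) $ k) \<longlonglongrightarrow> min_energy_potential (w a) (V a) $ k"
    by (intro tendsto_vec_nth tendsto_min_energy_potential w)
next
  fix n
  have L: "(\<lambda>a. (graph_laplacian (w a) + e *\<^sub>R mat 1) $ i $ j) \<in> borel_measurable M"
    for e i j unfolding graph_laplacian_def mat_def by simp
  have b: "(\<lambda>a. (- 2 *\<^sub>R divV (edge_flux (w a) (V a))) $ i) \<in> borel_measurable M" for i
    unfolding divV_def edge_flux_def by simp
  show "(\<lambda>a. tikhonov (graph_laplacian (w a)) (- 2 *\<^sub>R divV (edge_flux (w a) (V a)))
      (1 / real (Suc n)) $ k) \<in> borel_measurable M"
    unfolding tikhonov_def by (rule measurable_cramer_solve[OF L b])
qed

section \<open>Transition weights on the simplex\<close>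

lemma closed_prob_simplex: "closed (prob_simplex :: (real^'x::finite) set)"
proof -
  have "prob_simplex = (\<Inter>x. {\<nu>::real^'x. 0 \<le> \<nu>$x}) \<inter> {\<nu>. (\<Sum>x\<in>UNIV. \<nu>$x) = 1}"
    by (auto simp: prob_simplex_def)
  also have "closed \<dots>"
    by (intro closed_Int closed_INT ballI closed_Collect_le closed_Collect_eq continuous_intros)
  finally show ?thesis .
qed

lemma sets_prob_simplex[measurable]: "prob_simplex \<in> sets borel"
  by (rule borel_closed[OF closed_prob_simplex])

lemma prob_simplex_nth_bounds:
  assumes "\<nu> \<in> prob_simplex" shows "0 \<le> \<nu>$x" "\<nu>$x \<le> 1"
proof -
  show "0 \<le> \<nu>$x" using assms by (simp add: prob_simplex_def)
  have "\<nu>$x \<le> (\<Sum>y\<in>UNIV. \<nu>$y)"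
    using assms by (intro member_le_sum) (auto simp: prob_simplex_def)
  then show "\<nu>$x \<le> 1" using assms by (simp add: prob_simplex_def)
qed

lemma compact_prob_simplex: "compact (prob_simplex :: (real^'x::finite) set)"
proof -
  have "norm \<nu> \<le> real CARD('x)" if "\<nu> \<in> prob_simplex" for \<nu> :: "real^'x"
  proof -
    have "norm \<nu> \<le> (\<Sum>i\<in>UNIV. \<bar>\<nu>$i\<bar>)" by (rule norm_le_l1_cart)
    also have "\<dots> \<le> (\<Sum>i\<in>(UNIV::'x set). 1)"
      using prob_simplex_nth_bounds[OF that] by (intro sum_mono) auto
    finally show ?thesis by simp
  qed
  then have "bounded (prob_simplex :: (real^'x) set)" by (auto simp: bounded_iff)
  then show ?thesis using closed_prob_simplex by (simp add: compact_eq_bounded_closed)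
qed

lemma lipschitz_rates_bounded:
  fixes Q :: "real^'x::finite \<Rightarrow> 'x \<Rightarrow> 'x \<Rightarrow> real"
  assumes lip: "\<forall>x y. \<exists>L. L-lipschitz_on prob_simplex (\<lambda>\<mu>. Q \<mu> x y)"
  shows "\<exists>K\<ge>0. \<forall>\<mu>\<in>prob_simplex. \<forall>x y. \<bar>Q \<mu> x y\<bar> \<le> K"
proof -
  have "\<exists>K. \<forall>\<mu>\<in>prob_simplex. \<bar>Q \<mu> x y\<bar> \<le> K" for x y
  proof -
    obtain L where "L-lipschitz_on prob_simplex (\<lambda>\<mu>. Q \<mu> x y)" using lip by blast
    then have "continuous_on prob_simplex (\<lambda>\<mu>. Q \<mu> x y)" by (rule lipschitz_on_continuous_on)
    then have "bounded ((\<lambda>\<mu>. Q \<mu> x y) ` prob_simplex)"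
      by (intro compact_imp_bounded compact_continuous_image compact_prob_simplex)
    then show ?thesis by (auto simp: bounded_iff)
  qed
  then obtain K where K: "\<And>x y. \<forall>\<mu>\<in>prob_simplex. \<bar>Q \<mu> x y\<bar> \<le> K x y" by metis
  have "K x y \<le> Max (insert 0 (range (\<lambda>(x, y). K x y)))" for x y
    by (rule Max_ge) auto
  moreover have "0 \<le> Max (insert 0 (range (\<lambda>(x, y). K x y)))"
    by (rule Max_ge) auto
  ultimately show ?thesis using K by (meson order_trans)
qed

lemma Lam_zero: "s = 0 \<or> t = 0 \<Longrightarrow> Lam s t = 0"
  unfolding Lam_def by auto

lemma continuous_on_Lam: "continuous_on {p. 0 < fst p \<and> 0 < snd p} (\<lambda>p. Lam (fst p) (snd p))"
proof -
  have "continuous_on {p::real\<times>real. 0 < fst p \<and> 0 < snd p}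
      (\<lambda>p. integral (cbox 0 1) (\<lambda>a. fst p powr a * snd p powr (1 - a)))"
    by (rule integral_continuous_on_param) (auto intro!: continuous_intros simp: split_beta)
  then show ?thesis unfolding Lam_def by simp
qed

lemma Lam_nonneg: "0 \<le> s \<Longrightarrow> 0 \<le> t \<Longrightarrow> 0 \<le> Lam s t"
  unfolding Lam_def
  by (cases "(\<lambda>a. s powr a * t powr (1 - a)) integrable_on {0..1}")
     (auto intro!: integral_nonneg simp: not_integrable_integral)

lemma Lam_le_add: assumes "0 \<le> s" "0 \<le> t" shows "Lam s t \<le> s + t"
proof (cases "s = 0 \<or> t = 0")
  case True then show ?thesis using assms by (simp add: Lam_zero)
next
  case False
  then have st: "0 < s" "0 < t" using assms by auto
  define m where "m = max s t"
  have le: "s powr a * t powr (1 - a) \<le> m" if "a \<in> {0..1}" for a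
  proof -
    have "s powr a * t powr (1 - a) \<le> m powr a * m powr (1 - a)"
      using that st by (intro mult_mono powr_mono2) (auto simp: m_def)
    also have "\<dots> = m" using st by (simp add: powr_add[symmetric] m_def)
    finally show ?thesis .
  qed
  have int: "(\<lambda>a. s powr a * t powr (1 - a)) integrable_on {0..1}"
    using st by (intro integrable_continuous_interval continuous_intros) auto
  have "Lam s t \<le> m"
    using Henstock_Kurzweil_Integration.integral_le[OF int integrable_const_ivl le] unfolding Lam_def
    by simp
  then show ?thesis using st by (simp add: m_def)
qed

text \<open>\<open>Lam\<close> is only known to be continuous on the open quadrant; cutting it off there
  makes it Borel measurable without changing it on nonnegative arguments.\<close>
definition Lam_pos :: "real \<Rightarrow> real \<Rightarrow> real" where
  "Lam_pos s t = (if 0 < s \<and> 0 < t then Lam s t else 0)"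

lemma measurable_Lam_pos[measurable]: "(\<lambda>p. Lam_pos (fst p) (snd p)) \<in> borel_measurable borel"
proof -
  have "open {p::real\<times>real. 0 < fst p \<and> 0 < snd p}"
    by (intro open_Collect_conj open_Collect_less continuous_intros)
  then have "(\<lambda>p. if p \<in> {p::real\<times>real. 0 < fst p \<and> 0 < snd p} then Lam (fst p) (snd p) else 0)
      \<in> borel_measurable borel"
    by (intro borel_measurable_continuous_on_if continuous_on_Lam continuous_on_const borel_open)
  then show ?thesis unfolding Lam_pos_def by simp
qed

lemma Lam_pos_eq: "0 \<le> s \<Longrightarrow> 0 \<le> t \<Longrightarrow> Lam_pos s t = Lam s t"
  unfolding Lam_pos_def using Lam_zero[of s t] by auto

text \<open>Agrees with \<open>wt\<close> off the diagonal of the simplex, where the measures \<open>C t\<close> live, but unlike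
  \<open>wt\<close> it is Borel measurable.\<close>
definition edge_weight :: "(real^'x::finite \<Rightarrow> 'x \<Rightarrow> 'x \<Rightarrow> real) \<Rightarrow> real^'x \<Rightarrow> 'x \<Rightarrow> 'x \<Rightarrow> real" where
  "edge_weight Q \<nu> x y =
     (if \<nu> \<in> prob_simplex \<and> x \<noteq> y then Lam_pos (\<nu>$x * Q \<nu> x y) (\<nu>$y * Q \<nu> y x) else 0)"

lemma edge_weight_nonneg: "0 \<le> edge_weight Q \<nu> x y"
  unfolding edge_weight_def Lam_pos_def by (auto intro: Lam_nonneg)

context
  fixes Q :: "real^'x::finite \<Rightarrow> 'x \<Rightarrow> 'x \<Rightarrow> real"
  assumes rates: "\<forall>\<mu>\<in>prob_simplex. \<forall>x y. x \<noteq> y \<longrightarrow> 0 \<le> Q \<mu> x y"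
begin

lemma prob_simplex_mult_rate_nonneg:
  assumes "\<nu> \<in> prob_simplex" "x \<noteq> y"
  shows "0 \<le> \<nu>$x * Q \<nu> x y"
  using assms rates prob_simplex_nth_bounds(1)[OF assms(1)] by (simp add: mult_nonneg_nonneg)

lemma wt_eq_edge_weight:
  assumes "\<nu> \<in> prob_simplex" "x \<noteq> y"
  shows "wt Q \<nu> x y = edge_weight Q \<nu> x y"
proof -
  have "0 \<le> \<nu>$y * Q \<nu> y x" using assms by (intro prob_simplex_mult_rate_nonneg) auto
  then show ?thesis
    using assms prob_simplex_mult_rate_nonneg[OF assms] unfolding wt_def edge_weight_def
    by (simp add: Lam_pos_eq)
qed

lemma edge_weight_le:
  assumes K: "0 \<le> K" "\<forall>\<mu>\<in>prob_simplex. \<forall>x y. \<bar>Q \<mu> x y\<bar> \<le> K"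
  shows "edge_weight Q \<nu> x y \<le> 2 * K"
proof (cases "\<nu> \<in> prob_simplex \<and> x \<noteq> y")
  case True
  have bound: "\<nu>$a * Q \<nu> a b \<le> K" if "a \<noteq> b" for a b
  proof -
    have "\<nu>$a * Q \<nu> a b \<le> 1 * \<bar>Q \<nu> a b\<bar>"
      using True that rates prob_simplex_nth_bounds by (intro mult_mono) auto
    moreover have "\<bar>Q \<nu> a b\<bar> \<le> K" using K True by blast
    ultimately show ?thesis by linarith
  qed
  have "edge_weight Q \<nu> x y \<le> \<nu>$x * Q \<nu> x y + \<nu>$y * Q \<nu> y x"
    using True prob_simplex_mult_rate_nonneg[of \<nu> x y] prob_simplex_mult_rate_nonneg[of \<nu> y x]
    by (auto simp: edge_weight_def Lam_pos_eq Lam_le_add)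
  moreover have "y \<noteq> x" using True by auto
  ultimately show ?thesis using bound[of x y] bound[of y x] True by linarith
next
  case False
  then show ?thesis using K by (auto simp: edge_weight_def)
qed

end

lemma measurable_edge_weight[measurable]:
  fixes Q :: "real^'x::finite \<Rightarrow> 'x \<Rightarrow> 'x \<Rightarrow> real"
  assumes lip: "\<forall>x y. \<exists>L. L-lipschitz_on prob_simplex (\<lambda>\<mu>. Q \<mu> x y)"
  shows "(\<lambda>\<nu>. edge_weight Q \<nu> x y) \<in> borel_measurable borel"
proof -
  define Qs where "Qs \<nu> x y = indicator prob_simplex \<nu> *\<^sub>R Q \<nu> x y" for \<nu> x y
  have [measurable]: "(\<lambda>\<nu>. Qs \<nu> x y) \<in> borel_measurable borel" for x y
    using lip lipschitz_on_continuous_on unfolding Qs_def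
    by (metis borel_measurable_continuous_on_indicator sets_prob_simplex)
  have "(\<lambda>\<nu>. Lam_pos (\<nu>$x * Qs \<nu> x y) (\<nu>$y * Qs \<nu> y x)) \<in> borel_measurable borel"
    using measurable_compose[OF _ measurable_Lam_pos, of "\<lambda>\<nu>. (\<nu>$x * Qs \<nu> x y, \<nu>$y * Qs \<nu> y x)"]
    by simp
  then have "(\<lambda>\<nu>. if \<nu> \<in> prob_simplex \<and> x \<noteq> y then Lam_pos (\<nu>$x * Qs \<nu> x y) (\<nu>$y * Qs \<nu> y x) else 0)
      \<in> borel_measurable borel"
    by measurable
  then show ?thesis by (simp add: edge_weight_def Qs_def cong: if_cong)
qed

section \<open>Edge actions\<close>

text \<open>\<open>vecA Q \<nu>\<close> is \<open>edge_action (wt Q \<nu>)\<close>.\<close>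
definition edge_action :: "('x::finite \<Rightarrow> 'x \<Rightarrow> real) \<Rightarrow> ('x \<Rightarrow> 'x \<Rightarrow> real) \<Rightarrow> ennreal" where
  "edge_action w V = ennreal (1/2) * (\<Sum>x\<in>UNIV. \<Sum>y\<in>UNIV - {x}. alpha (V x y) (w x y))"

lemma measurable_alpha[measurable]:
  assumes [measurable]: "f \<in> borel_measurable M" "g \<in> borel_measurable M"
  shows "(\<lambda>a. alpha (f a) (g a)) \<in> borel_measurable M"
  unfolding alpha_def by measurable

lemma measurable_edge_action[measurable]:
  assumes [measurable]: "\<And>x y. (\<lambda>a. w a x y) \<in> borel_measurable M" "\<And>x y. (\<lambda>a. V a x y) \<in> borel_measurable M"
  shows "(\<lambda>a. edge_action (w a) (V a)) \<in> borel_measurable M"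
  unfolding edge_action_def by measurable

lemma alpha_finite:
  assumes "0 \<le> w" "alpha v w \<noteq> \<top>"
  shows "v \<noteq> 0 \<Longrightarrow> 0 < w" and "alpha v w = ennreal (if 0 < w then v\<^sup>2 / w else 0)"
  using assms by (auto simp: alpha_def split: if_splits)

lemma sum_UNIV_minus_diagonal:
  fixes f :: "'x::finite \<Rightarrow> 'a::comm_monoid_add"
  shows "f x = 0 \<Longrightarrow> (\<Sum>y\<in>UNIV - {x}. f y) = (\<Sum>y\<in>UNIV. f y)"
  by (rule sum.mono_neutral_left) auto

context
  fixes w V :: "'x::finite \<Rightarrow> 'x \<Rightarrow> real"
  assumes w: "\<And>x y. 0 \<le> w x y" and fin: "edge_action w V \<noteq> \<top>"
begin

lemma alpha_finite_of_edge_action: "x \<noteq> y \<Longrightarrow> alpha (V x y) (w x y) \<noteq> \<top>"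
  using fin unfolding edge_action_def by (auto simp: ennreal_mult_eq_top_iff)

lemma edge_flux_eq_of_edge_action: "x \<noteq> y \<Longrightarrow> edge_flux w V x y = V x y"
  using alpha_finite(1)[OF w alpha_finite_of_edge_action] by (auto simp: edge_flux_def)

lemma edge_action_eq_flux_energy: "edge_action w V = ennreal (flux_energy w V / 2)"
proof -
  define h where "h x y = (if x \<noteq> y \<and> 0 < w x y then (V x y)\<^sup>2 / w x y else 0)" for x y
  have h: "0 \<le> h x y" for x y by (simp add: h_def)
  have "(\<Sum>y\<in>UNIV - {x}. alpha (V x y) (w x y)) = ennreal (\<Sum>y\<in>UNIV. h x y)" for x
  proof -
    have "(\<Sum>y\<in>UNIV - {x}. alpha (V x y) (w x y)) = (\<Sum>y\<in>UNIV - {x}. ennreal (h x y))"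
      using alpha_finite(2)[OF w alpha_finite_of_edge_action] by (intro sum.cong) (auto simp: h_def)
    also have "\<dots> = ennreal (\<Sum>y\<in>UNIV - {x}. h x y)" using h by simp
    also have "(\<Sum>y\<in>UNIV - {x}. h x y) = (\<Sum>y\<in>UNIV. h x y)"
      by (rule sum_UNIV_minus_diagonal) (simp add: h_def)
    finally show ?thesis .
  qed
  then have "edge_action w V = ennreal (1/2) * ennreal (\<Sum>x\<in>UNIV. \<Sum>y\<in>UNIV. h x y)"
    unfolding edge_action_def using h by (simp add: sum_nonneg)
  also have "\<dots> = ennreal (1/2 * (\<Sum>x\<in>UNIV. \<Sum>y\<in>UNIV. h x y))"
    by (rule ennreal_mult[symmetric]) (auto intro!: sum_nonneg h)
  also have "\<dots> = ennreal (flux_energy w V / 2)"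
    by (simp add: flux_energy_def h_def)
  finally show ?thesis .
qed

lemma divV_min_energy_potential_of_edge_action:
  defines "p \<equiv> min_energy_potential w V"
  shows "divV (\<lambda>x y. w x y * (p$y - p$x)) = divV V"
proof -
  have "edge_flux w V y z - edge_flux w V z y = V y z - V z y" for y z
    by (cases "y = z") (simp_all add: edge_flux_eq_of_edge_action)
  then show ?thesis
    unfolding p_def divV_min_energy_potential[where w=w and V=V, OF w] by (simp add: divV_def)
qed

end

lemma dirichlet_energy_le_edge_action:
  assumes w: "\<And>x y. 0 \<le> w x y"
  shows "ennreal (dirichlet_energy w (min_energy_potential w V) / 2) \<le> edge_action w V"
proof (cases "edge_action w V = \<top>")
  case False
  then show ?thesis
    using dirichlet_energy_min_energy_potential_le[where w=w and V=V, OF w]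
    unfolding edge_action_eq_flux_energy[where w=w and V=V, OF w False] by (simp add: ennreal_leI)
qed simp

text \<open>By \<open>|w g| \<le> w/2 + w g\<^sup>2/2\<close>, the flux along one edge is controlled by the action.\<close>
lemma flux_min_energy_potential_le:
  fixes w V :: "'x::finite \<Rightarrow> 'x \<Rightarrow> real"
  assumes w: "\<And>x y. 0 \<le> w x y" and K: "\<And>x y. w x y \<le> K"
  defines "p \<equiv> min_energy_potential w V"
  shows "ennreal \<bar>w x y * (p$y - p$x)\<bar> \<le> ennreal (K / 2) + edge_action w V"
proof -
  let ?g = "p$y - p$x"
  have "w x y * ?g\<^sup>2 \<le> (\<Sum>y'\<in>UNIV. w x y' * (p$y' - p$x)\<^sup>2)"
    by (rule member_le_sum[of y UNIV "\<lambda>y'. w x y' * (p$y' - p$x)\<^sup>2"]) (auto intro: w mult_nonneg_nonneg)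
  also have "\<dots> \<le> dirichlet_energy w p"
    unfolding dirichlet_energy_def
    by (rule member_le_sum[of x UNIV "\<lambda>x'. \<Sum>y'\<in>UNIV. w x' y' * (p$y' - p$x')\<^sup>2"])
       (auto intro!: sum_nonneg mult_nonneg_nonneg w)
  finally have D: "w x y * ?g\<^sup>2 \<le> dirichlet_energy w p" .
  have "\<bar>?g\<bar> \<le> (1 + ?g\<^sup>2) / 2"
    using sum_squares_bound[of 1 "\<bar>?g\<bar>"] by (simp add: power2_eq_square)
  then have "w x y * \<bar>?g\<bar> \<le> w x y * ((1 + ?g\<^sup>2) / 2)"
    by (rule mult_left_mono) (rule w)
  then have "\<bar>w x y * ?g\<bar> \<le> w x y * ((1 + ?g\<^sup>2) / 2)"
    using w[of x y] by (simp only: abs_mult abs_of_nonneg)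
  also have "\<dots> = w x y / 2 + w x y * ?g\<^sup>2 / 2"
    by (simp add: add_divide_distrib distrib_left)
  also have "\<dots> \<le> K / 2 + dirichlet_energy w p / 2"
    using K[of x y] D by linarith
  finally have "\<bar>w x y * ?g\<bar> \<le> K / 2 + dirichlet_energy w p / 2" .
  then have "ennreal \<bar>w x y * ?g\<bar> \<le> ennreal (K / 2) + ennreal (dirichlet_energy w p / 2)"
    using w[of x y] K[of x y] dirichlet_energy_nonneg[where w=w and p=p, OF w]
    by (simp add: ennreal_plus[symmetric] del: ennreal_plus)
  also have "\<dots> \<le> ennreal (K / 2) + edge_action w V"
    unfolding p_def by (intro add_left_mono dirichlet_energy_le_edge_action w)
  finally show ?thesis .
qed

section \<open>The optimal potential\<close>

text \<open>Outside the simplex, a null set for every \<open>C t\<close>, the potential is set to zero.\<close>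
definition optimal_potential :: "(real^'x::finite \<Rightarrow> 'x \<Rightarrow> 'x \<Rightarrow> real) \<Rightarrow> (real \<Rightarrow> real^'x \<Rightarrow> 'x \<Rightarrow> 'x \<Rightarrow> real)
    \<Rightarrow> real \<Rightarrow> real^'x \<Rightarrow> 'x \<Rightarrow> real" where
  "optimal_potential Q V t \<nu> x =
     (if \<nu> \<in> prob_simplex then min_energy_potential (edge_weight Q \<nu>) (V t \<nu>) $ x else 0)"

context
  fixes Q :: "real^'x::finite \<Rightarrow> 'x \<Rightarrow> 'x \<Rightarrow> real"
  assumes rates: "\<forall>\<mu>\<in>prob_simplex. \<forall>x y. x \<noteq> y \<longrightarrow> 0 \<le> Q \<mu> x y"
begin

lemma wt_flux_optimal_potential:
  "wt Q \<nu> x y * (optimal_potential Q V t \<nu> y - optimal_potential Q V t \<nu> x)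
     = edge_weight Q \<nu> x y * (optimal_potential Q V t \<nu> y - optimal_potential Q V t \<nu> x)"
  by (cases "\<nu> \<in> prob_simplex \<and> x \<noteq> y")
     (auto simp: optimal_potential_def wt_eq_edge_weight[OF rates])

lemma vecA_eq_edge_action:
  "\<nu> \<in> prob_simplex \<Longrightarrow> vecA Q \<nu> V = edge_action (edge_weight Q \<nu>) V"
  unfolding vecA_def edge_action_def by (simp add: wt_eq_edge_weight[OF rates])

lemma Aact_optimal_potential_le:
  assumes \<nu>: "\<nu> \<in> prob_simplex"
  shows "Aact Q \<nu> (optimal_potential Q V t \<nu>) \<le> vecA Q \<nu> (V t \<nu>)"
proof -
  define p where "p = min_energy_potential (edge_weight Q \<nu>) (V t \<nu>)"
  have "(\<Sum>y\<in>UNIV - {x}. (optimal_potential Q V t \<nu> y - optimal_potential Q V t \<nu> x)\<^sup>2 * wt Q \<nu> x y)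
      = (\<Sum>y\<in>UNIV. edge_weight Q \<nu> x y * (p$y - p$x)\<^sup>2)" for x
    using \<nu> wt_eq_edge_weight[OF rates \<nu>]
    by (subst sum_UNIV_minus_diagonal[symmetric])
       (auto simp: p_def optimal_potential_def intro!: sum.cong)
  then have "Aact Q \<nu> (optimal_potential Q V t \<nu>) = ennreal (dirichlet_energy (edge_weight Q \<nu>) p / 2)"
    by (simp add: Aact_def dirichlet_energy_def)
  also have "\<dots> \<le> vecA Q \<nu> (V t \<nu>)"
    unfolding p_def vecA_eq_edge_action[OF \<nu>]
    by (rule dirichlet_energy_le_edge_action) (rule edge_weight_nonneg)
  finally show ?thesis .
qed

lemma divV_optimal_potential:
  assumes \<nu>: "\<nu> \<in> prob_simplex" and fin: "vecA Q \<nu> (V t \<nu>) \<noteq> \<top>"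
  shows "divV (\<lambda>x y. wt Q \<nu> x y * (optimal_potential Q V t \<nu> y - optimal_potential Q V t \<nu> x))
           = divV (V t \<nu>)"
proof -
  have "edge_action (edge_weight Q \<nu>) (V t \<nu>) \<noteq> \<top>"
    using fin vecA_eq_edge_action[OF \<nu>] by simp
  from divV_min_energy_potential_of_edge_action[OF edge_weight_nonneg this]
  show ?thesis unfolding wt_flux_optimal_potential by (simp add: optimal_potential_def \<nu>)
qed

lemma flux_optimal_potential_le:
  assumes K: "\<And>\<nu> x y. edge_weight Q \<nu> x y \<le> K"
  shows "ennreal \<bar>wt Q \<nu> x y * (optimal_potential Q V t \<nu> y - optimal_potential Q V t \<nu> x)\<bar>
           \<le> ennreal (K / 2) + edge_action (edge_weight Q \<nu>) (V t \<nu>)"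
proof (cases "\<nu> \<in> prob_simplex")
  case True
  then show ?thesis
    unfolding wt_flux_optimal_potential
    by (simp add: optimal_potential_def flux_min_energy_potential_le edge_weight_nonneg K)
qed (simp add: optimal_potential_def)

end

lemma measurable_snd_borel: "snd \<in> borel_measurable (borel :: ('a::second_countable_topology \<times> 'b::second_countable_topology) measure)"
  by (intro borel_measurable_continuous_onI continuous_intros)

context
  fixes Q :: "real^'x::finite \<Rightarrow> 'x \<Rightarrow> 'x \<Rightarrow> real" and V :: "real \<Rightarrow> real^'x \<Rightarrow> 'x \<Rightarrow> 'x \<Rightarrow> real"
  assumes lip: "\<forall>x y. \<exists>L. L-lipschitz_on prob_simplex (\<lambda>\<mu>. Q \<mu> x y)"
    and V: "\<forall>x y. (\<lambda>(t, \<nu>). V t \<nu> x y) \<in> borel_measurable borel"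
begin

lemma measurable_edge_weight_snd[measurable]:
  "(\<lambda>z :: real \<times> (real^'x). edge_weight Q (snd z) x y) \<in> borel_measurable borel"
  by (rule measurable_compose[OF measurable_snd_borel measurable_edge_weight[OF lip]])

lemma measurable_V_split[measurable]: "(\<lambda>z. V (fst z) (snd z) x y) \<in> borel_measurable borel"
  using V by (simp add: split_beta')

lemma measurable_optimal_potential:
  "(\<lambda>(t, \<nu>). optimal_potential Q V t \<nu> x) \<in> borel_measurable borel"
proof -
  have "(\<lambda>z :: real \<times> (real^'x). min_energy_potential (edge_weight Q (snd z)) (V (fst z) (snd z)) $ x)
      \<in> borel_measurable borel"
    by (rule measurable_min_energy_potential) (auto intro: edge_weight_nonneg)
  moreover have "(\<lambda>z :: real \<times> (real^'x). snd z \<in> prob_simplex) \<in> borel \<rightarrow>\<^sub>M count_space UNIV"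
    using measurable_snd_borel by (rule pred_sets2[OF sets_prob_simplex])
  ultimately show ?thesis
    unfolding optimal_potential_def split_beta' by measurable
qed

lemma measurable_edge_action_split:
  "(\<lambda>(t, \<nu>). edge_action (edge_weight Q \<nu>) (V t \<nu>)) \<in> borel_measurable borel"
  unfolding split_beta' by measurable

end

section \<open>Measurable kernels from weak continuity\<close>

lemma PP_D:
  assumes "M \<in> PP"
  shows "prob_space M" "sets M = sets borel" "AE \<nu> in M. \<nu> \<in> prob_simplex"
proof -
  show P: "prob_space M" and S: "sets M = sets borel" using assms unfolding PP_def by auto
  interpret prob_space M by (rule P)
  have "prob prob_simplex = 1" using assms emeasure_eq_measure by (simp add: PP_def)
  then show "AE \<nu> in M. \<nu> \<in> prob_simplex" using AE_in_set_eq_1 S by simp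
qed

lemma LIMSEQ_cutoff_indicator_closed:
  fixes F :: "'a::metric_space set"
  assumes "closed F" "F \<noteq> {}"
  shows "(\<lambda>n. max 0 (1 - real n * infdist x F)) \<longlonglongrightarrow> indicator F x"
proof (cases "x \<in> F")
  case False
  then have pos: "0 < infdist x F" using assms infdist_pos_not_in_closed by blast
  obtain N :: nat where N: "1 / infdist x F < real N" using reals_Archimedean2 by blast
  have "eventually (\<lambda>n. max 0 (1 - real n * infdist x F) = 0) sequentially"
  proof (rule eventually_sequentiallyI)
    fix n assume "N \<le> n"
    then have "1 / infdist x F < real n" using N by (meson less_le_trans of_nat_le_iff)
    then show "max 0 (1 - real n * infdist x F) = 0" using pos by (simp add: field_simps)
  qed
  then show ?thesis using False by (simp add: tendsto_eventually)
qed simp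

text \<open>A family of Borel probability measures is a measurable kernel as soon as the integrals of
  bounded continuous functions depend measurably on the parameter: closed sets are limits of
  such functions, and they generate the Borel sets.\<close>
lemma measurable_kernel_of_integrals:
  fixes K :: "'a \<Rightarrow> 'b::metric_space measure"
  assumes P: "\<And>a. prob_space (K a)" and S: "\<And>a. sets (K a) = sets borel"
    and int: "\<And>f :: 'b \<Rightarrow> real. continuous_on UNIV f \<Longrightarrow> bounded (range f) \<Longrightarrow>
                (\<lambda>a. \<integral>x. f x \<partial>K a) \<in> borel_measurable M"
  shows "K \<in> M \<rightarrow>\<^sub>M subprob_algebra borel"
proof (rule measurable_subprob_algebra_generated[where \<Omega>=UNIV and G="Collect closed"])
  show "sets borel = sigma_sets UNIV (Collect closed)" unfolding borel_eq_closed by simp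
  show "Int_stable (Collect closed)" by (auto simp: Int_stable_def)
  show "subprob_space (K a)" for a using P by (rule prob_space_imp_subprob_space)
  show "(\<lambda>a. emeasure (K a) UNIV) \<in> borel_measurable M"
    using prob_space.emeasure_space_1[OF P] sets_eq_imp_space_eq[OF S] by simp
  fix F :: "'b set" assume "F \<in> Collect closed"
  then have F: "closed F" by simp
  show "(\<lambda>a. emeasure (K a) F) \<in> borel_measurable M"
  proof (cases "F = {}")
    case False
    define f where "f n x = max 0 (1 - real n * infdist x F)" for n and x :: 'b
    have cont: "continuous_on UNIV (f n)" for n
      unfolding f_def by (intro continuous_intros continuous_on_infdist)
    have bound: "\<bar>f n x\<bar> \<le> 1" for n x
      unfolding f_def using infdist_nonneg[of x F] by (auto simp: abs_if)
    have "(\<lambda>n. \<integral>x. f n x \<partial>K a) \<longlonglongrightarrow> measure (K a) F" for a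
    proof -
      interpret prob_space "K a" by (rule P)
      have "(\<lambda>n. \<integral>x. f n x \<partial>K a) \<longlonglongrightarrow> (\<integral>x. indicator F x \<partial>K a)"
      proof (rule integral_dominated_convergence[where w="\<lambda>_. 1"])
        show "f n \<in> borel_measurable (K a)" for n
          using borel_measurable_continuous_onI[OF cont] S by (simp cong: measurable_cong_sets)
        show "AE x in K a. (\<lambda>n. f n x) \<longlonglongrightarrow> indicator F x"
          unfolding f_def using LIMSEQ_cutoff_indicator_closed[OF F False] by simp
        show "indicator F \<in> borel_measurable (K a)"
          by (rule borel_measurable_indicator) (simp add: S F borel_closed)
      qed (use bound in auto)
      then show ?thesis using F S by (simp add: borel_closed)
    qed
    moreover have "(\<lambda>a. \<integral>x. f n x \<partial>K a) \<in> borel_measurable M" for n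
      by (rule int[OF cont]) (use bound in \<open>auto simp: bounded_iff\<close>)
    ultimately have "(\<lambda>a. measure (K a) F) \<in> borel_measurable M"
      by (rule borel_measurable_LIMSEQ_real)
    then show ?thesis using finite_measure.emeasure_eq_measure[OF prob_space.finite_measure[OF P]] by simp
  qed simp
qed (use S in auto)

lemma nn_integral_measurable_kernel:
  fixes f :: "'a::second_countable_topology \<Rightarrow> 'b::second_countable_topology \<Rightarrow> ennreal"
  assumes K: "K \<in> borel \<rightarrow>\<^sub>M subprob_algebra borel"
    and f: "(\<lambda>(t, \<nu>). f t \<nu>) \<in> borel_measurable borel"
  shows "(\<lambda>t. \<integral>\<^sup>+\<nu>. f t \<nu> \<partial>K t) \<in> borel_measurable borel"
  by (rule nn_integral_measurable_subprob_algebra2[OF _ K]) (use f in \<open>simp add: borel_prod\<close>)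

lemma integral_measurable_kernel:
  fixes f :: "'a::second_countable_topology \<Rightarrow> 'b::second_countable_topology \<Rightarrow> real"
  assumes K: "K \<in> borel \<rightarrow>\<^sub>M subprob_algebra borel"
    and f: "(\<lambda>(t, \<nu>). f t \<nu>) \<in> borel_measurable borel"
  shows "(\<lambda>t. \<integral>\<nu>. f t \<nu> \<partial>K t) \<in> borel_measurable borel"
proof -
  have f2[measurable]: "(\<lambda>(t, \<nu>). f t \<nu>) \<in> borel_measurable (borel \<Otimes>\<^sub>M borel)"
    using f by (simp add: borel_prod)
  have D: "(\<lambda>t. distr (K t) (borel \<Otimes>\<^sub>M borel) (Pair t)) \<in> borel \<rightarrow>\<^sub>M subprob_algebra (borel \<Otimes>\<^sub>M borel)"
    by (rule measurable_distr2[OF _ K]) (simp add: case_prod_beta' measurable_ident_sets)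
  have "(\<integral>z. (\<lambda>(t, \<nu>). f t \<nu>) z \<partial>distr (K t) (borel \<Otimes>\<^sub>M borel) (Pair t)) = (\<integral>\<nu>. f t \<nu> \<partial>K t)" for t
  proof -
    have "sets (K t) = sets borel" using measurable_space[OF K, of t] by (simp add: space_subprob_algebra)
    then have "Pair t \<in> K t \<rightarrow>\<^sub>M borel \<Otimes>\<^sub>M borel"
      by (simp cong: measurable_cong_sets)
    then show ?thesis by (subst integral_distr[OF _ f2]) simp_all
  qed
  with measurable_compose[OF D integral_measurable_subprob_algebra[OF f2]] show ?thesis by simp
qed

context
  fixes T :: real and C :: "real \<Rightarrow> (real^'x::finite) measure"
  assumes T: "0 \<le> T" and PP: "\<forall>t\<in>{0..T}. C t \<in> PP" and wc: "weakly_cont T C"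
begin

lemma measurable_weakly_cont_extension:
  "(\<lambda>t. if t \<in> {0..T} then C t else C 0) \<in> borel \<rightarrow>\<^sub>M subprob_algebra borel"
proof (rule measurable_kernel_of_integrals)
  have "(if t \<in> {0..T} then C t else C 0) \<in> PP" for t using PP T by auto
  then show "prob_space (if t \<in> {0..T} then C t else C 0)"
    and "sets (if t \<in> {0..T} then C t else C 0) = sets borel" for t
    using PP_D by blast+
  fix f :: "real^'x \<Rightarrow> real" assume "continuous_on UNIV f" "bounded (range f)"
  then have "continuous_on {0..T} (\<lambda>t. \<integral>\<nu>. f \<nu> \<partial>C t)" using wc by (simp add: weakly_cont_def)
  then have "(\<lambda>t. if t \<in> {0..T} then \<integral>\<nu>. f \<nu> \<partial>C t else \<integral>\<nu>. f \<nu> \<partial>C 0) \<in> borel_measurable borel"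
    by (intro borel_measurable_continuous_on_if continuous_on_const) auto
  then show "(\<lambda>t. \<integral>\<nu>. f \<nu> \<partial>(if t \<in> {0..T} then C t else C 0)) \<in> borel_measurable borel"
    by (simp add: if_distrib[of "\<lambda>M. integral\<^sup>L M f"])
qed

lemma measurable_section_weakly_cont:
  assumes f: "(\<lambda>(t, \<nu>). f t \<nu>) \<in> borel_measurable borel" and t: "t \<in> {0..T}"
  shows "f t \<in> borel_measurable (C t)"
proof -
  have "(\<lambda>\<nu>. (\<lambda>(t, \<nu>). f t \<nu>) (t, \<nu>)) \<in> borel_measurable borel"
    using measurable_Pair2[of "\<lambda>(t, \<nu>). f t \<nu>" borel borel borel t] f by (simp add: borel_prod)
  moreover have "C t \<in> PP" using PP t by auto
  then have S: "sets (C t) = sets borel" by (rule PP_D(2))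
  ultimately show ?thesis unfolding measurable_cong_sets[OF S refl] by simp
qed

lemma nn_integral_weakly_cont_measurable:
  assumes "(\<lambda>(t, \<nu>). f t \<nu>) \<in> borel_measurable borel"
  shows "(\<lambda>t. indicator {0..T} t * (\<integral>\<^sup>+\<nu>. f t \<nu> \<partial>C t)) \<in> borel_measurable borel"
proof -
  have "(\<lambda>t. \<integral>\<^sup>+\<nu>. f t \<nu> \<partial>(if t \<in> {0..T} then C t else C 0)) \<in> borel_measurable borel"
    by (rule nn_integral_measurable_kernel[OF measurable_weakly_cont_extension assms])
  then have "(\<lambda>t. indicator {0..T} t * (\<integral>\<^sup>+\<nu>. f t \<nu> \<partial>(if t \<in> {0..T} then C t else C 0)))
      \<in> borel_measurable borel"
    by measurable
  then show ?thesis by (rule measurable_cong[THEN iffD1, rotated]) (simp add: indicator_def)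
qed

lemma integral_weakly_cont_measurable:
  fixes f :: "real \<Rightarrow> real^'x \<Rightarrow> real"
  assumes "(\<lambda>(t, \<nu>). f t \<nu>) \<in> borel_measurable borel"
  shows "(\<lambda>t. indicator {0..T} t * (\<integral>\<nu>. f t \<nu> \<partial>C t)) \<in> borel_measurable borel"
proof -
  have "(\<lambda>t. \<integral>\<nu>. f t \<nu> \<partial>(if t \<in> {0..T} then C t else C 0)) \<in> borel_measurable borel"
    by (rule integral_measurable_kernel[OF measurable_weakly_cont_extension assms])
  then have "(\<lambda>t. indicator {0..T} t * (\<integral>\<nu>. f t \<nu> \<partial>(if t \<in> {0..T} then C t else C 0)))
      \<in> borel_measurable borel"
    by measurable
  then show ?thesis by (rule measurable_cong[THEN iffD1, rotated]) (simp add: indicator_def)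
qed

context
  fixes f :: "real \<Rightarrow> real^'x \<Rightarrow> ennreal"
  assumes f: "(\<lambda>(t, \<nu>). f t \<nu>) \<in> borel_measurable borel"
    and fin: "(\<integral>\<^sup>+t. indicator {0..T} t * (\<integral>\<^sup>+\<nu>. f t \<nu> \<partial>C t) \<partial>lborel) < \<infinity>"
begin

lemma AE_finite_of_nn_integral_finite:
  "AE t in lborel. t \<in> {0..T} \<longrightarrow> (AE \<nu> in C t. f t \<nu> \<noteq> \<top>)"
proof -
  have "AE t in lborel. indicator {0..T} t * (\<integral>\<^sup>+\<nu>. f t \<nu> \<partial>C t) \<noteq> \<top>"
    using nn_integral_PInf_AE[of "\<lambda>t. indicator {0..T} t * (\<integral>\<^sup>+\<nu>. f t \<nu> \<partial>C t)" lborel]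
      nn_integral_weakly_cont_measurable[OF f] fin by simp
  then show ?thesis
  proof eventually_elim
    case (elim t)
    show ?case
    proof
      assume t: "t \<in> {0..T}"
      with elim have "(\<integral>\<^sup>+\<nu>. f t \<nu> \<partial>C t) \<noteq> \<top>" by simp
      then show "AE \<nu> in C t. f t \<nu> \<noteq> \<top>"
        using nn_integral_PInf_AE[OF measurable_section_weakly_cont[OF f t]] by simp
    qed
  qed
qed

lemma nn_integral_finite_of_le_const_plus:
  assumes c: "0 \<le> c" and g: "\<And>t \<nu>. g t \<nu> \<le> ennreal c + f t \<nu>"
  shows "(\<integral>\<^sup>+t. indicator {0..T} t * (\<integral>\<^sup>+\<nu>. g t \<nu> \<partial>C t) \<partial>lborel) < \<infinity>"
proof -
  have "indicator {0..T} t * (\<integral>\<^sup>+\<nu>. g t \<nu> \<partial>C t)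
      \<le> ennreal c * indicator {0..T} t + indicator {0..T} t * (\<integral>\<^sup>+\<nu>. f t \<nu> \<partial>C t)" for t
  proof (cases "t \<in> {0..T}")
    case True
    interpret prob_space "C t" using PP_D(1) PP True by blast
    have "(\<integral>\<^sup>+\<nu>. g t \<nu> \<partial>C t) \<le> (\<integral>\<^sup>+\<nu>. ennreal c + f t \<nu> \<partial>C t)"
      by (intro nn_integral_mono g)
    also have "\<dots> = ennreal c + (\<integral>\<^sup>+\<nu>. f t \<nu> \<partial>C t)"
      using measurable_section_weakly_cont[OF f True] by (simp add: nn_integral_add emeasure_space_1)
    finally show ?thesis using True by simp
  qed simp
  then have "(\<integral>\<^sup>+t. indicator {0..T} t * (\<integral>\<^sup>+\<nu>. g t \<nu> \<partial>C t) \<partial>lborel)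
      \<le> (\<integral>\<^sup>+t. ennreal c * indicator {0..T} t + indicator {0..T} t * (\<integral>\<^sup>+\<nu>. f t \<nu> \<partial>C t) \<partial>lborel)"
    by (rule nn_integral_mono)
  also have "\<dots> = ennreal c * ennreal T + (\<integral>\<^sup>+t. indicator {0..T} t * (\<integral>\<^sup>+\<nu>. f t \<nu> \<partial>C t) \<partial>lborel)"
    using nn_integral_weakly_cont_measurable[OF f] T by (simp add: nn_integral_add nn_integral_cmult_indicator)
  also have "\<dots> < \<infinity>"
    using fin by (simp add: ennreal_mult_less_top)
  finally show ?thesis .
qed

end

lemma test_integral_divV_cong:
  fixes D :: "real \<times> (real^'x) \<Rightarrow> real \<times> (real^'x)" and X Y :: "real \<Rightarrow> real^'x \<Rightarrow> 'x \<Rightarrow> 'x \<Rightarrow> real"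
  assumes D: "continuous_on UNIV D"
    and X: "\<forall>x y. (\<lambda>(t, \<nu>). X t \<nu> x y) \<in> borel_measurable borel"
    and Y: "\<forall>x y. (\<lambda>(t, \<nu>). Y t \<nu> x y) \<in> borel_measurable borel"
    and div: "AE t in lborel. t \<in> {0..T} \<longrightarrow> (AE \<nu> in C t. divV (X t \<nu>) = divV (Y t \<nu>))"
  shows "(\<integral>t. indicator {0..T} t * (\<integral>\<nu>. fst (D (t, \<nu>)) - snd (D (t, \<nu>)) \<bullet> divV (X t \<nu>) \<partial>C t) \<partial>lborel)
       = (\<integral>t. indicator {0..T} t * (\<integral>\<nu>. fst (D (t, \<nu>)) - snd (D (t, \<nu>)) \<bullet> divV (Y t \<nu>) \<partial>C t) \<partial>lborel)"
proof -
  have [measurable]: "(\<lambda>z. fst (D z)) \<in> borel_measurable borel" "(\<lambda>z. snd (D z) $ i) \<in> borel_measurable borel"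
    for i using D by (auto intro!: borel_measurable_continuous_onI continuous_intros)
  define F where "F Z t \<nu> = fst (D (t, \<nu>)) - snd (D (t, \<nu>)) \<bullet> divV (Z t \<nu>)"
    for Z :: "real \<Rightarrow> real^'x \<Rightarrow> 'x \<Rightarrow> 'x \<Rightarrow> real" and t \<nu>
  have F_measurable: "(\<lambda>(t, \<nu>). F Z t \<nu>) \<in> borel_measurable borel"
    if "\<forall>x y. (\<lambda>(t, \<nu>). Z t \<nu> x y) \<in> borel_measurable borel" for Z
  proof -
    have [measurable]: "(\<lambda>z :: real \<times> (real^'x). Z (fst z) (snd z) x y) \<in> borel_measurable borel"
      for x y
      using that by (simp add: split_beta')
    show ?thesis
      unfolding F_def split_beta' prod.collapse inner_vec_def inner_real_def divV_def vec_lambda_beta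
      by measurable
  qed
  have "AE t in lborel. indicator {0..T} t * (\<integral>\<nu>. F X t \<nu> \<partial>C t)
      = indicator {0..T} t * (\<integral>\<nu>. F Y t \<nu> \<partial>C t)"
    using div
  proof eventually_elim
    case (elim t)
    show ?case
    proof (cases "t \<in> {0..T}")
      case True
      with elim have "(\<integral>\<nu>. F X t \<nu> \<partial>C t) = (\<integral>\<nu>. F Y t \<nu> \<partial>C t)"
        by (intro integral_cong_AE measurable_section_weakly_cont F_measurable X Y)
           (auto simp: F_def elim: AE_mp)
      then show ?thesis by simp
    qed simp
  qed
  moreover have "(\<lambda>t. indicator {0..T} t * (\<integral>\<nu>. F X t \<nu> \<partial>C t)) \<in> borel_measurable borel"
    "(\<lambda>t. indicator {0..T} t * (\<integral>\<nu>. F Y t \<nu> \<partial>C t)) \<in> borel_measurable borel"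
    by (rule integral_weakly_cont_measurable[OF F_measurable[OF X]]
        integral_weakly_cont_measurable[OF F_measurable[OF Y]])+
  ultimately show ?thesis unfolding F_def[symmetric] by (intro integral_cong_AE) auto
qed

end

lemma vCE_divV_cong:
  fixes C :: "real \<Rightarrow> (real^'x::finite) measure" and V W :: "real \<Rightarrow> real^'x \<Rightarrow> 'x \<Rightarrow> 'x \<Rightarrow> real"
  assumes CV: "vCE T M N C V" and T: "0 \<le> T"
    and W: "\<forall>x y. (\<lambda>(t, \<nu>). W t \<nu> x y) \<in> borel_measurable borel"
    and W_int: "\<forall>x y. (\<integral>\<^sup>+t. indicator {0..T} t * (\<integral>\<^sup>+\<nu>. ennreal \<bar>W t \<nu> x y\<bar> \<partial>C t) \<partial>lborel) < \<infinity>"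
    and div: "AE t in lborel. t \<in> {0..T} \<longrightarrow> (AE \<nu> in C t. divV (W t \<nu>) = divV (V t \<nu>))"
  shows "vCE T M N C W"
proof -
  have PP: "\<forall>t\<in>{0..T}. C t \<in> PP" and wc: "weakly_cont T C"
    and V: "\<forall>x y. (\<lambda>(t, \<nu>). V t \<nu> x y) \<in> borel_measurable borel"
    using CV by (auto simp: vCE_def)
  have "(\<integral>t. indicator {0..T} t * (\<integral>\<nu>. fst (D (t, \<nu>)) - snd (D (t, \<nu>)) \<bullet> divV (W t \<nu>) \<partial>C t) \<partial>lborel)
      = 0" if "test_fun T \<phi> D" for \<phi> D
  proof -
    have "continuous_on UNIV D" using that by (simp add: test_fun_def)
    with test_integral_divV_cong[OF T PP wc _ W V div] show ?thesis
      using CV that by (simp add: vCE_def)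
  qed
  with CV W W_int show ?thesis by (simp add: vCE_def)
qed

section \<open>The optimal potential solves the continuity equation\<close>

context
  fixes Q :: "real^'x::finite \<Rightarrow> 'x \<Rightarrow> 'x \<Rightarrow> real" and T :: real
    and C :: "real \<Rightarrow> (real^'x) measure" and V :: "real \<Rightarrow> real^'x \<Rightarrow> 'x \<Rightarrow> 'x \<Rightarrow> real"
  assumes rates: "\<forall>\<mu>\<in>prob_simplex. \<forall>x y. x \<noteq> y \<longrightarrow> 0 \<le> Q \<mu> x y"
    and PP: "\<forall>t\<in>{0..T}. C t \<in> PP"
begin

lemma vAction_eq_edge_action:
  "vAction Q T C V
     = (\<integral>\<^sup>+t. indicator {0..T} t * (\<integral>\<^sup>+\<nu>. edge_action (edge_weight Q \<nu>) (V t \<nu>) \<partial>C t) \<partial>lborel)"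
  unfolding vAction_def
proof (intro nn_integral_cong)
  fix t :: real
  show "indicator {0..T} t * (\<integral>\<^sup>+\<nu>. vecA Q \<nu> (V t \<nu>) \<partial>C t)
      = indicator {0..T} t * (\<integral>\<^sup>+\<nu>. edge_action (edge_weight Q \<nu>) (V t \<nu>) \<partial>C t)"
  proof (cases "t \<in> {0..T}")
    case True
    have "AE \<nu> in C t. vecA Q \<nu> (V t \<nu>) = edge_action (edge_weight Q \<nu>) (V t \<nu>)"
      by (rule PP_D(3)[OF PP[rule_format, OF True], THEN AE_mp]) (simp add: vecA_eq_edge_action[OF rates])
    then show ?thesis by (simp add: nn_integral_cong_AE)
  qed simp
qed

lemma Action_optimal_potential_le: "Action Q T C (optimal_potential Q V) \<le> vAction Q T C V"
  unfolding Action_def vAction_def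
proof (intro nn_integral_mono)
  fix t :: real
  show "indicator {0..T} t * (\<integral>\<^sup>+\<nu>. Aact Q \<nu> (optimal_potential Q V t \<nu>) \<partial>C t)
      \<le> indicator {0..T} t * (\<integral>\<^sup>+\<nu>. vecA Q \<nu> (V t \<nu>) \<partial>C t)"
  proof (cases "t \<in> {0..T}")
    case True
    have "AE \<nu> in C t. Aact Q \<nu> (optimal_potential Q V t \<nu>) \<le> vecA Q \<nu> (V t \<nu>)"
      by (rule PP_D(3)[OF PP[rule_format, OF True], THEN AE_mp]) (simp add: Aact_optimal_potential_le[OF rates])
    then show ?thesis by (intro mult_left_mono nn_integral_mono_AE) auto
  qed simp
qed

end

context
  fixes Q :: "real^'x::finite \<Rightarrow> 'x \<Rightarrow> 'x \<Rightarrow> real" and T :: real and M N :: "(real^'x) measure"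
    and C :: "real \<Rightarrow> (real^'x) measure" and V :: "real \<Rightarrow> real^'x \<Rightarrow> 'x \<Rightarrow> 'x \<Rightarrow> real"
  assumes rates: "\<forall>\<mu>\<in>prob_simplex. \<forall>x y. x \<noteq> y \<longrightarrow> 0 \<le> Q \<mu> x y"
    and lip: "\<forall>x y. \<exists>L. L-lipschitz_on prob_simplex (\<lambda>\<mu>. Q \<mu> x y)"
    and T: "0 \<le> T" and CV: "vCE T M N C V" and fin: "vAction Q T C V < \<infinity>"
begin

lemma vCE_D:
  "\<forall>t\<in>{0..T}. C t \<in> PP" "weakly_cont T C" "\<forall>x y. (\<lambda>(t, \<nu>). V t \<nu> x y) \<in> borel_measurable borel"
  using CV by (auto simp: vCE_def)

lemma edge_action_integral_finite:
  "(\<integral>\<^sup>+t. indicator {0..T} t * (\<integral>\<^sup>+\<nu>. edge_action (edge_weight Q \<nu>) (V t \<nu>) \<partial>C t) \<partial>lborel) < \<infinity>"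
  using fin vAction_eq_edge_action[OF rates vCE_D(1)] by simp

lemmas edge_action_kernel_facts =
  T vCE_D(1,2) measurable_edge_action_split[OF lip vCE_D(3)] edge_action_integral_finite

lemma flux_optimal_potential_integrable:
  "(\<integral>\<^sup>+t. indicator {0..T} t * (\<integral>\<^sup>+\<nu>. ennreal \<bar>wt Q \<nu> x y *
      (optimal_potential Q V t \<nu> y - optimal_potential Q V t \<nu> x)\<bar> \<partial>C t) \<partial>lborel) < \<infinity>"
proof -
  obtain K where K: "0 \<le> K" "\<forall>\<mu>\<in>prob_simplex. \<forall>x y. \<bar>Q \<mu> x y\<bar> \<le> K"
    using lipschitz_rates_bounded[OF lip] by blast
  show ?thesis
  proof (rule nn_integral_finite_of_le_const_plus[OF edge_action_kernel_facts])
    show "0 \<le> K" by fact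
    show "ennreal \<bar>wt Q \<nu> x y * (optimal_potential Q V t \<nu> y - optimal_potential Q V t \<nu> x)\<bar>
        \<le> ennreal K + edge_action (edge_weight Q \<nu>) (V t \<nu>)" for t \<nu>
      using flux_optimal_potential_le[OF rates edge_weight_le[OF rates K], of \<nu> x y V t] by simp
  qed
qed

lemma AE_divV_optimal_potential:
  "AE t in lborel. t \<in> {0..T} \<longrightarrow> (AE \<nu> in C t. divV (\<lambda>x y. wt Q \<nu> x y *
      (optimal_potential Q V t \<nu> y - optimal_potential Q V t \<nu> x)) = divV (V t \<nu>))"
  using AE_finite_of_nn_integral_finite[OF edge_action_kernel_facts]
proof eventually_elim
  case (elim t)
  show ?case
  proof
    assume t: "t \<in> {0..T}"
    with elim have "AE \<nu> in C t. edge_action (edge_weight Q \<nu>) (V t \<nu>) \<noteq> \<top>" by simp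
    with PP_D(3)[OF vCE_D(1)[rule_format, OF t]]
    show "AE \<nu> in C t. divV (\<lambda>x y. wt Q \<nu> x y *
        (optimal_potential Q V t \<nu> y - optimal_potential Q V t \<nu> x)) = divV (V t \<nu>)"
      by eventually_elim (simp add: divV_optimal_potential[OF rates] vecA_eq_edge_action[OF rates])
  qed
qed

lemma CE_optimal_potential: "CE Q T M N C (optimal_potential Q V)"
  unfolding CE_def
proof (rule vCE_divV_cong[OF CV T _ _ AE_divV_optimal_potential])
  have [measurable]: "(\<lambda>z. optimal_potential Q V (fst z) (snd z) x) \<in> borel_measurable borel"
    "(\<lambda>z :: real \<times> (real^'x). edge_weight Q (snd z) x y) \<in> borel_measurable borel" for x y
    using measurable_optimal_potential[OF lip vCE_D(3)] measurable_edge_weight_snd[OF lip vCE_D(3)]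
    by (simp_all add: split_beta')
  show "\<forall>x y. (\<lambda>(t, \<nu>). wt Q \<nu> x y * (optimal_potential Q V t \<nu> y - optimal_potential Q V t \<nu> x))
      \<in> borel_measurable borel"
    unfolding wt_flux_optimal_potential[OF rates] split_beta' by measurable
qed (use flux_optimal_potential_integrable in blast)

end

theorem proposition2p18:
  fixes Q :: "real^'x::finite \<Rightarrow> 'x \<Rightarrow> 'x \<Rightarrow> real"
    and T :: real
    and M N :: "(real^'x) measure"
    and C :: "real \<Rightarrow> (real^'x) measure"
    and V :: "real \<Rightarrow> real^'x \<Rightarrow> 'x \<Rightarrow> 'x \<Rightarrow> real"
  assumes rates: "\<forall>\<mu>\<in>prob_simplex. \<forall>x y. x \<noteq> y \<longrightarrow> 0 \<le> Q \<mu> x y"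
    and irred: "\<forall>\<mu>\<in>prob_simplex. irreducible_rates (Q \<mu>)"
    and rev: "\<forall>\<mu>\<in>prob_simplex. reversible_gibbs (Q \<mu>)"
    and lip: "\<forall>x y. \<exists>L. L-lipschitz_on prob_simplex (\<lambda>\<mu>. Q \<mu> x y)"
    and T: "0 < T"
    and M: "M \<in> PP" and N: "N \<in> PP"
    and CV: "vCE T M N C V"
    and fin: "vAction Q T C V < \<infinity>"
  shows "\<exists>\<Psi> :: real \<Rightarrow> real^'x \<Rightarrow> 'x \<Rightarrow> real.
           (\<forall>x. (\<lambda>(t, \<nu>). \<Psi> t \<nu> x) \<in> borel_measurable borel) \<and>
           CE Q T M N C \<Psi> \<and> Action Q T C \<Psi> \<le> vAction Q T C V"
proof (intro exI conjI allI)
  have V: "\<forall>x y. (\<lambda>(t, \<nu>). V t \<nu> x y) \<in> borel_measurable borel"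
    and PP: "\<forall>t\<in>{0..T}. C t \<in> PP"
    using CV by (auto simp: vCE_def)
  show "(\<lambda>(t, \<nu>). optimal_potential Q V t \<nu> x) \<in> borel_measurable borel" for x
    by (rule measurable_optimal_potential[OF lip V])
  show "CE Q T M N C (optimal_potential Q V)"
    using CE_optimal_potential[OF rates lip _ CV fin] T by simp
  show "Action Q T C (optimal_potential Q V) \<le> vAction Q T C V"
    by (rule Action_optimal_potential_le[OF rates PP])
qed

end
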